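(* Let $d\ge1$ and $p>q>d/2$, and let $f_1(r)=r^{-p}$, $f_2(r)=r^{-q}$ for $r>0$. Let $L\in\mathcal L(1)$. If $\zeta_L^\pm(2q)<0$, then the function $V\mapsto E^\pm_{f_1,f_2}[V^{1/d}L]$ is decreasing on $(0,V_L)$ and increasing on $(V_L,+\infty)$, where $$V_L=\left(\frac{p\,\zeta_L(2p)}{-q\,\zeta_L^\pm(2q)}\right)^{\frac{d}{2(p-q)}}>0,$$ and its minimum is $$\min_{V>0}E^\pm_{f_1,f_2}[V^{1/d}L]=E^\pm_{f_1,f_2}[V_L^{1/d}L]=\frac{(q-p)\left(-q\,\zeta_L^\pm(2q)\right)^{\frac{p}{p-q}}}{qp\,\left(p\,\zeta_L(2p)\right)^{\frac{q}{p-q}}}<0.$$ If $\zeta_L^\pm(2q)\ge0$, then $V\mapsto E^\pm_{f_1,f_2}[V^{1/d}L]$ is strictly decreasing on $(0,+\infty)$ and does not have any minimizer.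
   Context: A lattice in $\mathbb R^d$ is a set $L=\bigoplus_{i=1}^d\mathbb Zu_i$ for a basis $\{u_1,\dots,u_d\}$ of $\mathbb R^d$ (fixed together with $L$; the dilate $V^{1/d}L$ is given the basis $V^{1/d}u_i$). $\mathcal L(1)$ is the set of lattices with $|\det(u_1,\dots,u_d)|=1$. The alternate charge distribution on $L$ is $\varphi_\pm(\sum_i m_iu_i)=+1$ if $\sum_i m_i$ is even and $-1$ otherwise. The alternating-charge energy is $$E^\pm_{f_1,f_2}[L]=\sum_{p\in L\setminus\{0\}}f_1(|p|^2)+\sum_{p\in L\setminus\{0\}}\varphi_\pm(p)f_2(|p|^2).$$ For $s>d$, the Epstein zeta function and alternating Epstein zeta function are $$\zeta_L(s)=\sum_{p\in L\setminus\{0\}}\frac1{|p|^s},\qquad \zeta_L^\pm(s)=\sum_{p\in L\setminus\{0\}}\frac{\varphi_\pm(p)}{|p|^s}.$$ *)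

theory Defs
  imports "HOL-Analysis.Analysis"
begin

text \<open>
  A lattice is always taken together with a fixed basis, so it is represented by that
  basis \<open>u\<close>; the underlying point set is \<open>lattice_points u\<close>. The index type
  \<open>'n\<close> plays the role of \<open>{1,\<dots>,d}\<close>, with \<open>d = CARD('n)\<close>.
\<close>

type_synonym 'n based_lattice = "'n \<Rightarrow> real ^ 'n"

definition is_lattice_basis :: "'n::finite based_lattice \<Rightarrow> bool" where
  "is_lattice_basis u \<longleftrightarrow> inj u \<and> independent (range u) \<and> span (range u) = UNIV"

definition lattice_point :: "'n::finite based_lattice \<Rightarrow> ('n \<Rightarrow> int) \<Rightarrow> real ^ 'n" where
  "lattice_point u m = (\<Sum>i\<in>UNIV. of_int (m i) *\<^sub>R u i)"

definition lattice_points :: "'n::finite based_lattice \<Rightarrow> (real ^ 'n) set" where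
  "lattice_points u = range (lattice_point u)"

definition unit_lattices :: "'n::finite based_lattice set" where
  "unit_lattices = {u. is_lattice_basis u \<and> \<bar>det (\<chi> i. u i)\<bar> = 1}"

definition dilate :: "real \<Rightarrow> 'n::finite based_lattice \<Rightarrow> 'n based_lattice" where
  "dilate c u = (\<lambda>i. c *\<^sub>R u i)"

text \<open>
  Integer coordinates with respect to a basis are unique, so the existential below just
  picks the coordinates of \<open>x\<close> (see \<open>alt_charge_lattice_point\<close>). Values outside the
  lattice are irrelevant.
\<close>

definition alt_charge :: "'n::finite based_lattice \<Rightarrow> real ^ 'n \<Rightarrow> real" where
  "alt_charge u x =
     (if \<exists>m. x = lattice_point u m \<and> even (\<Sum>i\<in>UNIV. m i) then 1 else - 1)"

text \<open>
  On the reals \<open>infsum\<close> is the sum of an absolutely convergent family (and 0 by convention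
  otherwise). For the exponents considered (\<open>s > d\<close>) all series converge absolutely.
\<close>

definition alt_energy ::
    "(real \<Rightarrow> real) \<Rightarrow> (real \<Rightarrow> real) \<Rightarrow> 'n::finite based_lattice \<Rightarrow> real" where
  "alt_energy f1 f2 u =
     (\<Sum>\<^sub>\<infinity>x\<in>lattice_points u - {0}. f1 ((norm x)\<^sup>2)) +
     (\<Sum>\<^sub>\<infinity>x\<in>lattice_points u - {0}. alt_charge u x * f2 ((norm x)\<^sup>2))"

definition epstein_zeta :: "'n::finite based_lattice \<Rightarrow> real \<Rightarrow> real" where
  "epstein_zeta u s = (\<Sum>\<^sub>\<infinity>x\<in>lattice_points u - {0}. 1 / norm x powr s)"

definition alt_epstein_zeta :: "'n::finite based_lattice \<Rightarrow> real \<Rightarrow> real" where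
  "alt_epstein_zeta u s = (\<Sum>\<^sub>\<infinity>x\<in>lattice_points u - {0}. alt_charge u x / norm x powr s)"

lemma lattice_point_inj:
  fixes u :: "'n::finite based_lattice"
  assumes "is_lattice_basis u" "lattice_point u m = lattice_point u m'"
  shows "m = m'"
proof
  fix i
  have inj: "inj u" and ind: "independent (range u)"
    using assms(1) by (auto simp: is_lattice_basis_def)
  define c where "c = (\<lambda>v. real_of_int (m (inv u v) - m' (inv u v)))"
  have "(\<Sum>v\<in>range u. c v *\<^sub>R v) = (\<Sum>i\<in>UNIV. c (u i) *\<^sub>R u i)"
    by (simp add: sum.reindex[OF inj])
  also have "\<dots> = lattice_point u m - lattice_point u m'"
    using inj by (simp add: c_def lattice_point_def sum_subtractf scaleR_left_diff_distrib)
  also have "\<dots> = 0" using assms(2) by simp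
  finally have "(\<Sum>v\<in>range u. c v *\<^sub>R v) = 0" .
  then have "c (u i) = 0"
    using independentD[OF ind, of "range u" c "u i"] by simp
  then show "m i = m' i" using inj by (simp add: c_def)
qed

lemma alt_charge_lattice_point:
  assumes "is_lattice_basis u"
  shows "alt_charge u (lattice_point u m) = (if even (\<Sum>i\<in>UNIV. m i) then 1 else - 1)"
  unfolding alt_charge_def using lattice_point_inj[OF assms] by auto

end

theory Submission
  imports Defs
begin

text \<open>
  Scaling turns the energy of \<open>V powr (1 / d)\<close> times \<open>L\<close> into the two-term function
  \<open>A V powr (- P) + B V powr (- Q)\<close>, where \<open>P = 2 p / d\<close>, \<open>Q = 2 q / d\<close> and \<open>A\<close>, \<open>B\<close> are the
  two zeta values of \<open>L\<close>; the rest is one-variable calculus, using \<open>A > 0\<close>. Positivity of \<open>A\<close>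
  needs the convergence of the Epstein series: the norm of a nonzero lattice point dominates each
  of its integer coordinates, hence their geometric mean, so the series is dominated by
  a product of one-dimensional series with exponent \<open>s / d > 1\<close>.
\<close>

section \<open>Convergence and positivity of the Epstein series\<close>

text \<open>Every finite set of tuples lies in a finite box, over which the sum of products factors
  into one-dimensional sums, each at most \<open>infsum g UNIV\<close>. This bounds all finite
  partial sums, which suffices for nonnegative terms.\<close>

lemma nonneg_summable_on_prod:
  fixes g :: "'b \<Rightarrow> real"
  assumes "g summable_on UNIV" and nonneg: "\<And>k. 0 \<le> g k"
  shows "(\<lambda>m :: 'n::finite \<Rightarrow> 'b. \<Prod>i\<in>UNIV. g (m i)) summable_on UNIV"
proof (rule nonneg_bdd_above_summable_on)
  show "bdd_above (sum (\<lambda>m :: 'n \<Rightarrow> 'b. \<Prod>i\<in>UNIV. g (m i)) ` {F. F \<subseteq> UNIV \<and> finite F})"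
  proof (rule bdd_aboveI2)
    fix F :: "('n \<Rightarrow> 'b) set"
    assume "F \<in> {F. F \<subseteq> UNIV \<and> finite F}"
    then have fin: "finite F" by simp
    define B where "B = (\<lambda>i. (\<lambda>m. m i) ` F)"
    have finB: "finite (B i)" for i using fin by (simp add: B_def)
    have "(\<Sum>m\<in>F. \<Prod>i\<in>UNIV. g (m i)) \<le> (\<Sum>m\<in>PiE UNIV B. \<Prod>i\<in>UNIV. g (m i))"
      by (rule sum_mono2) (auto simp: B_def fin nonneg intro!: finite_PiE prod_nonneg)
    also have "\<dots> = (\<Prod>i\<in>UNIV. \<Sum>k\<in>B i. g k)"
      using finB by (simp add: prod_sum_PiE)
    also have "\<dots> \<le> (\<Prod>i\<in>(UNIV :: 'n set). infsum g UNIV)"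
      by (intro prod_mono conjI sum_nonneg finite_sum_le_infsum) (auto simp: nonneg assms(1) finB)
    finally show "(\<Sum>m\<in>F. \<Prod>i\<in>UNIV. g (m i)) \<le> (\<Prod>i\<in>(UNIV :: 'n set). infsum g UNIV)" .
  qed
qed (simp add: prod_nonneg nonneg)

text \<open>The integers are covered by two copies of the naturals, each carrying a shifted
  p-series. The shift by 1 gives a zero coordinate the factor 1; without it the convention
  \<open>0 powr (- a) = 0\<close> would make the dominating product vanish.\<close>

lemma summable_on_int_powr:
  assumes "a > 1"
  shows "(\<lambda>k :: int. (1 + \<bar>real_of_int k\<bar>) powr (- a)) summable_on UNIV"
proof -
  let ?g = "\<lambda>k :: int. (1 + \<bar>real_of_int k\<bar>) powr (- a)"
  have "summable (\<lambda>n. real (Suc n) powr (- a))"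
    using assms by (subst summable_Suc_iff) (simp add: summable_real_powr_iff)
  then have nat: "(\<lambda>n. (1 + real n) powr (- a)) summable_on UNIV"
    by (subst summable_on_UNIV_nonneg_real_iff) (simp_all add: add.commute)
  have pos: "?g summable_on range int" and neg: "?g summable_on range (\<lambda>n. - int n)"
    by (subst summable_on_reindex; simp add: o_def nat inj_on_def)+
  have "range int \<union> range (\<lambda>n. - int n) = UNIV"
  proof (rule UNIV_eq_I[symmetric])
    fix k :: int show "k \<in> range int \<union> range (\<lambda>n. - int n)" by (cases k rule: int_cases2) auto
  qed
  with summable_on_union[OF pos neg] show ?thesis by simp
qed

text \<open>The linear map from coordinates to vectors is injective, hence bounded below in finite
  dimension; \<open>K\<close> is the inverse of that bound.\<close>

lemma lattice_coord_le_norm: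
  fixes u :: "'n::finite based_lattice"
  assumes "is_lattice_basis u"
  obtains K where "K > 0" "\<And>m i. \<bar>of_int (m i)\<bar> \<le> K * norm (lattice_point u m)"
proof -
  define T where "T = (\<lambda>c :: real ^ 'n. \<Sum>i\<in>UNIV. (c $ i) *\<^sub>R u i)"
  have lin: "linear T"
    by (rule linearI) (simp_all add: T_def scaleR_add_left sum.distrib scaleR_sum_right)
  have inj_u: "inj u" and ind: "independent (range u)"
    using assms by (auto simp: is_lattice_basis_def)
  have "inj T"
  proof (subst linear_injective_0[OF lin], intro allI impI)
    fix c assume "T c = 0"
    \<comment> \<open>Independence concerns coefficients attached to the vectors of
      \<open>range u\<close>, so the coordinates are transported there along
      \<open>inv u\<close>.\<close>
    then have "(\<Sum>v\<in>range u. (c $ inv u v) *\<^sub>R v) = 0"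
      by (simp add: sum.reindex[OF inj_u] T_def inj_u)
    then have "c $ inv u (u i) = 0" for i
      using independentD[OF ind, of "range u" "\<lambda>v. c $ inv u v" "u i"] by simp
    then show "c = 0" by (simp add: vec_eq_iff inj_u)
  qed
  then obtain B where B: "B > 0" "\<And>c. B * norm c \<le> norm (T c)"
    using linear_inj_bounded_below_pos[OF lin] by blast
  have "\<bar>of_int (m i)\<bar> \<le> inverse B * norm (lattice_point u m)" for m :: "'n \<Rightarrow> int" and i
  proof -
    let ?c = "(\<chi> i. of_int (m i)) :: real ^ 'n"
    have "\<bar>of_int (m i)\<bar> \<le> norm ?c" using component_le_norm_cart[of ?c i] by simp
    also have "\<dots> \<le> inverse B * norm (T ?c)"
      using B by (simp add: field_simps)
    also have "T ?c = lattice_point u m" by (simp add: T_def lattice_point_def)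
    finally show ?thesis .
  qed
  with B(1) show ?thesis by (intro that[of "inverse B"]) auto
qed

lemma lattice_point_zero [simp]: "lattice_point u (\<lambda>_. 0) = 0"
  by (simp add: lattice_point_def)

lemma lattice_points_minus_zero:
  assumes "is_lattice_basis u"
  shows "lattice_points u - {0} = lattice_point u ` (- {\<lambda>_. 0})"
  using lattice_point_inj[OF assms, of _ "\<lambda>_. 0"] by (auto simp: lattice_points_def)

lemma epstein_summable:
  fixes u :: "'n::finite based_lattice"
  assumes u: "is_lattice_basis u" and s: "s > real CARD('n)"
  shows "(\<lambda>x. 1 / norm x powr s) summable_on lattice_points u - {0}"
proof -
  let ?d = "real CARD('n)"
  obtain K where K: "K > 0" "\<And>m i. \<bar>of_int (m i)\<bar> \<le> K * norm (lattice_point u m)"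
    using lattice_coord_le_norm[OF u] by blast
  \<comment> \<open>With this exponent, \<open>CARD('n)\<close> equal factors of power
    \<open>- a\<close> multiply to the power \<open>- s\<close>.\<close>
  define a where "a = s / ?d"
  have s_eq: "s = ?d * a" by (simp add: a_def)
  have "a > 1" using s by (simp add: a_def)
  have "(\<lambda>m. (2 * K) powr s * (\<Prod>i\<in>(UNIV :: 'n set). (1 + \<bar>of_int (m i)\<bar>) powr (- a)))
          summable_on - {\<lambda>_. 0}"
    by (rule summable_on_subset_banach[OF _ subset_UNIV], rule summable_on_cmult_right,
        rule nonneg_summable_on_prod[OF summable_on_int_powr[OF \<open>a > 1\<close>]]) simp
  then have "(\<lambda>m. 1 / norm (lattice_point u m) powr s) summable_on - {\<lambda>_. 0}"
  proof (rule summable_on_comparison_test)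
    fix m :: "'n \<Rightarrow> int"
    assume "m \<in> - {\<lambda>_. 0}"
    then obtain j where j: "m j \<noteq> 0" by auto
    let ?x = "lattice_point u m"
    \<comment> \<open>A nonzero integer coordinate is at least 1 in absolute value. This absorbs the
      summand 1 in \<open>1 + \<bar>of_int (m i)\<bar>\<close> at the price of the factor 2 in
      \<open>2 * K\<close>.\<close>
    have ge1: "1 \<le> K * norm ?x"
      using K(2)[of m j] j by linarith
    then have pos: "norm ?x > 0" using K(1) by (smt (verit) mult_nonneg_nonpos norm_ge_zero)
    have "(2 * K * norm ?x) powr (- s) = (\<Prod>i\<in>(UNIV :: 'n set). (2 * K * norm ?x) powr (- a))"
      using K(1) pos by (simp add: s_eq powr_power)
    also have "\<dots> \<le> (\<Prod>i\<in>(UNIV :: 'n set). (1 + \<bar>of_int (m i)\<bar>) powr (- a))"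
    proof (intro prod_mono conjI powr_mono2')
      show "1 + \<bar>real_of_int (m i)\<bar> \<le> 2 * K * norm ?x" for i
        using K(2)[of m i] ge1 by linarith
    qed (use \<open>a > 1\<close> in auto)
    finally have "(2 * K * norm ?x) powr (- s) \<le> \<dots>" .
    then show "1 / norm ?x powr s
        \<le> (2 * K) powr s * (\<Prod>i\<in>(UNIV :: 'n set). (1 + \<bar>of_int (m i)\<bar>) powr (- a))"
      using K(1) pos by (simp add: powr_mult powr_minus field_simps)
  qed simp
  moreover have "inj (lattice_point u)"
    using lattice_point_inj[OF u] by (auto intro: injI)
  ultimately show ?thesis
    by (simp add: lattice_points_minus_zero[OF u] summable_on_reindex inj_on_subset o_def)
qed

text \<open>If a convergent sum of nonnegative terms were at most 0, every term would vanish; the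
  lattice point with all coordinates 1 contradicts this. Summability is essential, as a divergent
  \<open>infsum\<close> is 0 by convention.\<close>

lemma epstein_zeta_pos:
  fixes u :: "'n::finite based_lattice"
  assumes u: "is_lattice_basis u" and s: "s > real CARD('n)"
  shows "epstein_zeta u s > 0"
proof (rule ccontr)
  let ?x = "lattice_point u (\<lambda>_. 1)"
  assume "\<not> epstein_zeta u s > 0"
  then have le: "infsum (\<lambda>x. 1 / norm x powr s) (lattice_points u - {0}) \<le> 0"
    by (simp add: epstein_zeta_def)
  have x: "?x \<in> lattice_points u - {0}"
    by (auto simp: lattice_points_minus_zero[OF u] fun_eq_iff)
  have "1 / norm ?x powr s = 0"
    by (rule nonneg_infsum_le_0D[OF le epstein_summable[OF u s] _ x]) simp
  with x show False by simp
qed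

section \<open>Scaling of the energy under dilation\<close>

lemma lattice_point_dilate: "lattice_point (dilate c u) m = c *\<^sub>R lattice_point u m"
  by (simp add: lattice_point_def dilate_def scaleR_sum_right mult.commute)

lemma dilate_lattice_points:
  assumes "c \<noteq> 0"
  shows "lattice_points (dilate c u) - {0} = (*\<^sub>R) c ` (lattice_points u - {0})"
  using assms by (auto simp: lattice_points_def lattice_point_dilate)

lemma alt_charge_dilate:
  assumes "c \<noteq> 0"
  shows "alt_charge (dilate c u) (c *\<^sub>R x) = alt_charge u x"
  using assms by (simp add: alt_charge_def lattice_point_dilate)

lemma infsum_dilate:
  fixes g :: "real ^ 'n::finite \<Rightarrow> real"
  assumes "c \<noteq> 0"
  shows "infsum g (lattice_points (dilate c u) - {0})
    = (\<Sum>\<^sub>\<infinity>x\<in>lattice_points u - {0}. g (c *\<^sub>R x))"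
  unfolding dilate_lattice_points[OF assms]
  using assms by (subst infsum_reindex) (auto simp: inj_on_def o_def)

lemma alt_energy_dilate:
  fixes u :: "'n::finite based_lattice"
  assumes c: "c > 0"
    and f1: "\<And>r. r > 0 \<Longrightarrow> f1 r = r powr (- p)"
    and f2: "\<And>r. r > 0 \<Longrightarrow> f2 r = r powr (- q)"
  shows "alt_energy f1 f2 (dilate c u)
    = epstein_zeta u (2 * p) * c powr (- 2 * p) + alt_epstein_zeta u (2 * q) * c powr (- 2 * q)"
proof -
  have eq: "((c * norm x)\<^sup>2) powr (- e) = c powr (- 2 * e) * (1 / norm x powr (2 * e))"
    if "x \<noteq> 0" for x :: "real ^ 'n" and e
  proof -
    have "((c * norm x)\<^sup>2) powr (- e) = (c * norm x) powr (- 2 * e)"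
      using c that by (simp add: powr_powr flip: powr_numeral)
    also have "\<dots> = c powr (- 2 * e) * (1 / norm x powr (2 * e))"
      using c by (simp add: powr_mult powr_minus divide_simps)
    finally show ?thesis .
  qed
  have "(\<Sum>\<^sub>\<infinity>x\<in>lattice_points u - {0}. f1 ((norm (c *\<^sub>R x))\<^sup>2))
      = (\<Sum>\<^sub>\<infinity>x\<in>lattice_points u - {0}. c powr (- 2 * p) * (1 / norm x powr (2 * p)))"
    using c by (intro infsum_cong) (simp add: f1 eq)
  also have "\<dots> = c powr (- 2 * p) * epstein_zeta u (2 * p)"
    \<comment> \<open>A constant factor leaves a real \<open>infsum\<close> regardless of
      convergence: a nonzero factor preserves summability, and divergent sums are 0 on both
      sides.\<close>
    unfolding epstein_zeta_def by (rule infsum_cmult_right')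
  finally have 1: "(\<Sum>\<^sub>\<infinity>x\<in>lattice_points u - {0}. f1 ((norm (c *\<^sub>R x))\<^sup>2)) = \<dots>" .
  have "(\<Sum>\<^sub>\<infinity>x\<in>lattice_points u - {0}. alt_charge u x * f2 ((norm (c *\<^sub>R x))\<^sup>2))
      = (\<Sum>\<^sub>\<infinity>x\<in>lattice_points u - {0}. c powr (- 2 * q) * (alt_charge u x / norm x powr (2 * q)))"
    using c by (intro infsum_cong) (simp add: f2 eq)
  also have "\<dots> = c powr (- 2 * q) * alt_epstein_zeta u (2 * q)"
    unfolding alt_epstein_zeta_def by (rule infsum_cmult_right')
  finally have 2: "(\<Sum>\<^sub>\<infinity>x\<in>lattice_points u - {0}. alt_charge u x * f2 ((norm (c *\<^sub>R x))\<^sup>2)) = \<dots>" .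
  show ?thesis
    using c 1 2 by (simp add: alt_energy_def infsum_dilate alt_charge_dilate mult.commute)
qed

section \<open>One-variable calculus for two power terms\<close>

text \<open>Pulling out the positive factor \<open>V powr (- P - 1)\<close> leaves a bracket affine
  in \<open>V powr (P - Q)\<close>, from which the sign of the derivative can be read off.\<close>

lemma two_powers_deriv:
  fixes A B P Q V :: real
  assumes "V > 0"
  shows "((\<lambda>V. A * V powr (- P) + B * V powr (- Q)) has_real_derivative
    V powr (- P - 1) * (- (Q * B) * V powr (P - Q) - P * A)) (at V)"
proof -
  have "V powr (- Q - 1) = V powr (- P - 1) * V powr (P - Q)"
    by (subst powr_add[symmetric]) (simp add: algebra_simps)
  then show ?thesis
    using assms by (auto intro!: derivative_eq_intros simp: algebra_simps)
qed

lemma two_powers_continuous_on: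
  fixes A B P Q :: real
  assumes "S \<subseteq> {0<..}"
  shows "continuous_on S (\<lambda>V. A * V powr (- P) + B * V powr (- Q))"
  using assms by (intro continuous_intros) auto

lemma two_powers_decreasing:
  fixes A B P Q :: real
  assumes "0 < Q" "Q < P" "0 < A" "0 \<le> B"
  shows "strict_antimono_on {0<..} (\<lambda>V. A * V powr (- P) + B * V powr (- Q))"
proof (rule monotone_onI)
  fix V W :: real
  assume "V \<in> {0<..}" "W \<in> {0<..}" "V < W"
  with assms have "W powr (- P) < V powr (- P)" "W powr (- Q) < V powr (- Q)"
    by (auto intro!: powr_less_mono2_neg)
  with assms show "A * W powr (- P) + B * W powr (- Q) < A * V powr (- P) + B * V powr (- Q)"
    by (intro add_less_le_mono mult_strict_left_mono mult_left_mono) auto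
qed

text \<open>For \<open>B < 0\<close> the bracket in the derivative is increasing in \<open>V\<close>
  and vanishes exactly at \<open>V0\<close>. Both monotonicity intervals include \<open>V0\<close>,
  so that every other point can be compared with it directly.\<close>

lemma two_powers_unimodal:
  fixes A B P Q :: real
  assumes PQ: "0 < Q" "Q < P" and AB: "0 < A" "B < 0"
  defines "h \<equiv> \<lambda>V. A * V powr (- P) + B * V powr (- Q)"
    and "V0 \<equiv> (P * A / (- Q * B)) powr (1 / (P - Q))"
  shows "V0 > 0"
    and "strict_antimono_on {0<..V0} h"
    and "strict_mono_on {V0..} h"
    and "h V0 = (Q - P) * (- Q * B) powr (P / (P - Q)) / (Q * P * (P * A) powr (Q / (P - Q)))"
proof -
  define b where "b = - Q * B"
  define a where "a = P * A"
  have b: "b > 0" using PQ AB by (simp add: b_def mult_pos_neg)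
  have a: "a > 0" using PQ AB by (simp add: a_def)
  have V0: "V0 = (a / b) powr (1 / (P - Q))" by (simp add: V0_def a_def b_def)
  show pos: "V0 > 0" using a b by (simp add: V0)
  have V0_pow: "V0 powr (P - Q) = a / b"
    using a b PQ by (simp add: V0 powr_powr)
  have deriv: "(h has_real_derivative V powr (- P - 1) * (b * V powr (P - Q) - a)) (at V)"
    if "V > 0" for V
    using two_powers_deriv[OF that, of A P B Q] by (simp add: h_def a_def b_def)
  have cont: "continuous_on {V..W} h" if "V > 0" for V W
    unfolding h_def by (rule two_powers_continuous_on) (use that in auto)
  have neg: "V powr (- P - 1) * (b * V powr (P - Q) - a) < 0" if "0 < V" "V < V0" for V
  proof -
    have "V powr (P - Q) < a / b"
      using that PQ powr_less_mono2[of "P - Q" V V0] by (simp add: V0_pow)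
    with that b show ?thesis by (simp add: mult_less_0_iff field_simps)
  qed
  have gt: "V powr (- P - 1) * (b * V powr (P - Q) - a) > 0" if "V0 < V" for V
  proof -
    have "a / b < V powr (P - Q)"
      using that pos PQ powr_less_mono2[of "P - Q" V0 V] by (simp add: V0_pow)
    with that pos b show ?thesis by (simp add: field_simps)
  qed
  \<comment> \<open>The derivative vanishes at \<open>V0\<close> itself; the mean value criterion
    used asks for its sign only on the open interval, with continuity on the closed one.\<close>
  show "strict_antimono_on {0<..V0} h"
  proof (rule monotone_onI)
    fix V W assume "V \<in> {0<..V0}" "W \<in> {0<..V0}" "V < W"
    then show "h W < h V"
      by (intro DERIV_neg_imp_decreasing_open[of V W h] cont) (auto intro!: exI deriv neg)
  qed
  show "strict_mono_on {V0..} h"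
  proof (rule monotone_onI)
    fix V W assume "V \<in> {V0..}" "W \<in> {V0..}" "V < W"
    then show "h V < h W"
      using pos by (intro DERIV_pos_imp_increasing_open[of V W h] cont) (auto intro!: exI deriv gt)
  qed
  \<comment> \<open>The critical equation trades the power \<open>- P\<close> for
    \<open>- Q\<close>, so the two terms of \<open>h V0\<close> share a factor. The remaining one
    simplifies by \<open>A = a / P\<close> and \<open>B = - b / Q\<close>.\<close>
  have "V0 powr (- P) = V0 powr (- Q) / V0 powr (P - Q)"
    by (simp flip: powr_diff)
  then have "h V0 = V0 powr (- Q) * (A * b / a + B)"
    by (simp add: h_def V0_pow algebra_simps)
  also have "A * b / a + B = b * (Q - P) / (Q * P)"
    using PQ AB by (simp add: a_def b_def field_simps)
  also have "V0 powr (- Q) = b powr (Q / (P - Q)) / a powr (Q / (P - Q))"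
    using a b by (simp add: V0 powr_powr powr_minus powr_divide)
  also have "b powr (Q / (P - Q)) / a powr (Q / (P - Q)) * (b * (Q - P) / (Q * P))
      = (Q - P) * (b powr 1 * b powr (Q / (P - Q))) / (Q * P * a powr (Q / (P - Q)))"
    using b by (simp add: mult_ac)
  \<comment> \<open>The exponents add up because
    \<open>1 + Q / (P - Q) = P / (P - Q)\<close>.\<close>
  also have "b powr 1 * b powr (Q / (P - Q)) = b powr (P / (P - Q))"
    using PQ by (subst powr_add[symmetric]) (simp add: add_divide_eq_iff)
  finally show "h V0 = (Q - P) * (- Q * B) powr (P / (P - Q)) / (Q * P * (P * A) powr (Q / (P - Q)))"
    by (simp add: a_def b_def)
qed

section \<open>Energy along the dilates of a unit lattice\<close>

theorem theorem2p4:
  fixes L :: "'n::finite based_lattice" and p q :: real and f1 f2 :: "real \<Rightarrow> real"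
  assumes "p > q" and "q > real CARD('n) / 2"
    and "\<And>r. r > 0 \<Longrightarrow> f1 r = r powr (- p)"
    and "\<And>r. r > 0 \<Longrightarrow> f2 r = r powr (- q)"
    and "L \<in> unit_lattices"
  shows "let d = real CARD('n);
             E = (\<lambda>V. alt_energy f1 f2 (dilate (V powr (1 / d)) L))
         in (alt_epstein_zeta L (2 * q) < 0 \<longrightarrow>
              (let V\<^sub>L = (p * epstein_zeta L (2 * p) / (- q * alt_epstein_zeta L (2 * q)))
                          powr (d / (2 * (p - q)))
               in V\<^sub>L > 0
                  \<and> strict_antimono_on {0<..<V\<^sub>L} E
                  \<and> strict_mono_on {V\<^sub>L<..} E
                  \<and> is_arg_min E (\<lambda>V. V > 0) V\<^sub>L
                  \<and> E V\<^sub>L = (q - p) * (- q * alt_epstein_zeta L (2 * q)) powr (p / (p - q))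
                              / (q * p * (p * epstein_zeta L (2 * p)) powr (q / (p - q)))
                  \<and> E V\<^sub>L < 0))
          \<and> (alt_epstein_zeta L (2 * q) \<ge> 0 \<longrightarrow>
              strict_antimono_on {0<..} E
              \<and> \<not> (\<exists>V. is_arg_min E (\<lambda>V. V > 0) V))"
proof -
  define d where "d = real CARD('n)"
  define A where "A = epstein_zeta L (2 * p)"
  define B where "B = alt_epstein_zeta L (2 * q)"
  define P where "P = 2 * p / d"
  define Q where "Q = 2 * q / d"
  define E where "E = (\<lambda>V. alt_energy f1 f2 (dilate (V powr (1 / d)) L))"
  define h where "h = (\<lambda>V. A * V powr (- P) + B * V powr (- Q))"
  have d: "d > 0" by (simp add: d_def)
  have q: "q > d / 2" using assms(2) by (simp add: d_def)
  have p: "p > q" using assms(1) .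
  have PQ: "0 < Q" "Q < P" using p q d by (simp_all add: P_def Q_def divide_strict_right_mono)
  have A: "A > 0"
    unfolding A_def using assms(5) p q
    by (intro epstein_zeta_pos) (auto simp: unit_lattices_def d_def)
  have E: "E V = h V" if "V > 0" for V
    using that
    by (simp add: E_def h_def A_def B_def P_def Q_def powr_powr
        alt_energy_dilate[OF _ assms(3) assms(4), where c = "V powr (1 / d)"])
  have neg: "V\<^sub>L > 0 \<and> strict_antimono_on {0<..<V\<^sub>L} E \<and> strict_mono_on {V\<^sub>L<..} E
      \<and> is_arg_min E (\<lambda>V. V > 0) V\<^sub>L
      \<and> E V\<^sub>L = (q - p) * (- q * B) powr (p / (p - q)) / (q * p * (p * A) powr (q / (p - q)))
      \<and> E V\<^sub>L < 0"
    if B: "B < 0" and V_def: "V\<^sub>L = (p * A / (- q * B)) powr (d / (2 * (p - q)))" for V\<^sub>L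
  proof -
    \<comment> \<open>The common factor \<open>2 / d\<close> of \<open>P\<close> and
      \<open>Q\<close> cancels in the base and is absorbed in the exponent.\<close>
    have V: "V\<^sub>L = (P * A / (- Q * B)) powr (1 / (P - Q))"
    proof -
      have "P * A / (- Q * B) = p * A / (- q * B)" "1 / (P - Q) = d / (2 * (p - q))"
        using d by (simp_all add: P_def Q_def divide_simps)
      then show ?thesis by (simp only: V_def)
    qed
    note uni = two_powers_unimodal[OF PQ A B, folded V h_def]
    have min: "h V\<^sub>L < h W" if "W > 0" "W \<noteq> V\<^sub>L" for W
      using that monotone_onD[OF uni(2), of W V\<^sub>L] monotone_onD[OF uni(3), of V\<^sub>L W] uni(1)
      by (cases "W < V\<^sub>L") auto
    have "strict_antimono_on {0<..<V\<^sub>L} E"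
      using monotone_onD[OF uni(2)] by (intro monotone_onI) (simp add: E)
    moreover have "strict_mono_on {V\<^sub>L<..} E"
      using monotone_onD[OF uni(3)] uni(1) by (intro monotone_onI) (simp add: E)
    moreover have "is_arg_min E (\<lambda>V. V > 0) V\<^sub>L"
      using min uni(1) unfolding is_arg_min_def by (metis E not_less_iff_gr_or_eq)
    moreover have val: "E V\<^sub>L
        = (q - p) * (- q * B) powr (p / (p - q)) / (q * p * (p * A) powr (q / (p - q)))"
    proof -
      \<comment> \<open>The value is known in terms of \<open>P = k * p\<close> and
        \<open>Q = k * q\<close>. Numerator and denominator both carry the factor
        \<open>k * k * k powr e\<close>, so \<open>k\<close> cancels.\<close>
      define k where "k = 2 / d"
      define e where "e = q / (p - q)"
      have k: "k > 0" using d by (simp add: k_def)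
      have kPQ: "P = k * p" "Q = k * q" by (simp_all add: P_def Q_def k_def)
      have pq: "p / (p - q) = 1 + e" using p by (simp add: e_def add_divide_eq_iff)
      have "P - Q = k * (p - q)" by (simp add: kPQ right_diff_distrib)
      then have exps: "Q / (P - Q) = e" "P / (P - Q) = 1 + e"
        using k by (simp_all add: kPQ pq flip: e_def)
      have "E V\<^sub>L = (Q - P) * (- Q * B) powr (1 + e) / (Q * P * (P * A) powr e)"
        unfolding E[OF uni(1)] h_def using uni(4) by (simp only: exps)
      moreover have "(- Q * B) powr (1 + e) = k * k powr e * (- q * B) powr (1 + e)"
        using k powr_mult[of k "- q * B" "1 + e"] by (simp add: kPQ powr_add mult_ac)
      moreover have "(P * A) powr e = k powr e * (p * A) powr e"
        using powr_mult[of k "p * A" e] by (simp add: kPQ mult_ac)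
      ultimately have "E V\<^sub>L = (k * (q - p)) * (k * k powr e * (- q * B) powr (1 + e))
          / (k * q * (k * p) * (k powr e * (p * A) powr e))"
        by (simp only: kPQ right_diff_distrib mult.assoc)
      also have "\<dots> = (q - p) * (- q * B) powr (1 + e) / (q * p * (p * A) powr e)"
        using k by simp
      finally show ?thesis by (simp only: pq flip: e_def)
    qed
    moreover have "E V\<^sub>L < 0"
    proof -
      \<comment> \<open>The sign of the value comes from the single negative factor
        \<open>q - p\<close>.\<close>
      have "q > 0" "p > 0" using p q d by linarith+
      then show ?thesis
        unfolding val using p by (intro divide_neg_pos mult_neg_pos mult_pos_pos) (use A B in simp_all)
    qed
    ultimately show ?thesis using uni(1) by blast
  qed
  have nonneg: "strict_antimono_on {0<..} E \<and> \<not> (\<exists>V. is_arg_min E (\<lambda>V. V > 0) V)" if "B \<ge> 0"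
  proof -
    have anti: "E W < E V" if "0 < V" "V < W" for V W
      using that monotone_onD[OF two_powers_decreasing[OF PQ A \<open>B \<ge> 0\<close>], of V W]
      by (simp add: E h_def)
    then have "strict_antimono_on {0<..} E"
      by (intro monotone_onI) auto
    \<comment> \<open>Any candidate \<open>V\<close> is beaten by the larger
      \<open>V + 1\<close>.\<close>
    moreover have "\<not> is_arg_min E (\<lambda>V. V > 0) V" for V
      using anti[of V "V + 1"] by (auto simp: is_arg_min_def intro!: exI[of _ "V + 1"])
    ultimately show ?thesis by blast
  qed
  show ?thesis
    unfolding Let_def
    by (rule conjI[OF impI impI],
        rule neg[OF _ refl, unfolded E_def A_def B_def d_def], assumption,
        rule nonneg[unfolded E_def A_def B_def d_def], assumption)
qed

end
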